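(* Let $t\geq 4$ and let $G$ be a simple connected $t$-tough graph with $n>10t-3$ vertices and $m$ edges. If $$m\geq\binom{n-2t}{2}+3t^{2},$$ then $G$ is Hamiltonian; moreover, $G$ is pancyclic or bipartite.
   Context: For a graph $H$, $c(H)$ denotes the number of connected components of $H$. For a positive real number $t$, a connected graph $G$ is called $t$-tough if $t\cdot c(G-S)\leq |S|$ for every vertex cut $S\subseteq V(G)$ (i.e., every $S$ with $c(G-S)\geq 2$); complete graphs are $t$-tough for every $t$. A graph on $n$ vertices is Hamiltonian if it has a cycle through all its vertices, and pancyclic if it contains cycles of every length $\ell$ with $3\leq \ell\leq n$. Here $\binom{x}{2}=x(x-1)/2$. *)

theory Defs
  imports Complex_Main
begin

type_synonym 'a ugraph = "'a set \<times> 'a set set"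

abbreviation verts :: "'a ugraph \<Rightarrow> 'a set" where "verts \<equiv> fst"
abbreviation edges :: "'a ugraph \<Rightarrow> 'a set set" where "edges \<equiv> snd"

definition simple_graph :: "'a ugraph \<Rightarrow> bool" where
  "simple_graph G \<longleftrightarrow> finite (verts G) \<and> edges G \<subseteq> {e. e \<subseteq> verts G \<and> card e = 2}"

definition reachable :: "'a ugraph \<Rightarrow> ('a \<times> 'a) set" where
  "reachable G = {(u, v). {u, v} \<in> edges G}\<^sup>* \<inter> verts G \<times> verts G"

definition components :: "'a ugraph \<Rightarrow> 'a set set" where
  "components G = verts G // reachable G"

definition num_components :: "'a ugraph \<Rightarrow> nat" where
  "num_components G = card (components G)"

definition connected_graph :: "'a ugraph \<Rightarrow> bool" where
  "connected_graph G \<longleftrightarrow> num_components G = 1"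

definition delete_verts :: "'a ugraph \<Rightarrow> 'a set \<Rightarrow> 'a ugraph" where
  "delete_verts G S = (verts G - S, {e \<in> edges G. e \<inter> S = {}})"

definition vertex_cut :: "'a ugraph \<Rightarrow> 'a set \<Rightarrow> bool" where
  "vertex_cut G S \<longleftrightarrow> S \<subseteq> verts G \<and> num_components (delete_verts G S) \<ge> 2"

text \<open>A complete graph has no vertex cut, so it is \<open>t\<close>-tough for every \<open>t\<close> without a
  separate clause.\<close>

definition tough :: "real \<Rightarrow> 'a ugraph \<Rightarrow> bool" where
  "tough t G \<longleftrightarrow> connected_graph G \<and>
     (\<forall>S. vertex_cut G S \<longrightarrow> t * real (num_components (delete_verts G S)) \<le> real (card S))"

text \<open>A cycle is given by the list of its vertices in cyclic order, the first vertex not being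
  repeated at the end; its length is the length of the list.\<close>

definition is_cycle :: "'a ugraph \<Rightarrow> 'a list \<Rightarrow> bool" where
  "is_cycle G p \<longleftrightarrow> length p \<ge> 3 \<and> distinct p \<and> set p \<subseteq> verts G \<and>
     (\<forall>i<length p. {p ! i, p ! (Suc i mod length p)} \<in> edges G)"

definition hamiltonian :: "'a ugraph \<Rightarrow> bool" where
  "hamiltonian G \<longleftrightarrow> (\<exists>p. is_cycle G p \<and> set p = verts G)"

definition pancyclic :: "'a ugraph \<Rightarrow> bool" where
  "pancyclic G \<longleftrightarrow> (\<forall>l. 3 \<le> l \<and> l \<le> card (verts G) \<longrightarrow> (\<exists>p. is_cycle G p \<and> length p = l))"

definition bipartite :: "'a ugraph \<Rightarrow> bool" where
  "bipartite G \<longleftrightarrow> (\<exists>A B. A \<union> B = verts G \<and> A \<inter> B = {} \<and>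
     (\<forall>e\<in>edges G. \<exists>a\<in>A. \<exists>b\<in>B. e = {a, b}))"

lemma gchoose_two_real: "(x::real) gchoose 2 = x * (x - 1) / 2"
  by (simp add: numeral_2_eq_2 gbinomial_Suc prod.atLeast0_lessThan_Suc atLeast0AtMost[symmetric]
      atLeastLessThanSuc_atLeastAtMost[symmetric])

end

theory Submission
  imports Defs
begin

text \<open>Suppose \<open>G\<close> is not Hamiltonian. The argument of Chvatal and Erdos gives an independent set of
  more than \<open>2t\<close> vertices, and toughness bounds independent sets by \<open>n / (t + 1)\<close>, so
  \<open>n \<ge> (2t + 1)(t + 1)\<close>. Add edges until the graph is maximal non-Hamiltonian. Then nonadjacent
  \<open>x\<close>, \<open>y\<close> are joined by a Hamiltonian path, and toughness strengthens the usual crossing argument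
  to \<open>deg x + deg y \<le> n - 2\<close>. Choose such a pair with maximal degree sum and \<open>i = deg x \<le> deg y\<close>:
  at least \<open>i + 1\<close> vertices are not adjacent to \<open>y\<close>, they all have degree at most \<open>i\<close>, and they span
  at least \<open>i + 1 - n / (t + 1)\<close> edges. The resulting upper bound on the number of edges is convex in
  \<open>i \<in> [2t, (n - 2) / 2]\<close> and contradicts the hypothesis at both ends. Finally \<open>m > n\<^sup>2 / 4\<close>, so
  \<open>G\<close> is pancyclic by Bondy's theorem.\<close>

section \<open>Lists as paths and closed paths of a relation\<close>

definition walk_in :: "('a \<times> 'a) set \<Rightarrow> 'a list \<Rightarrow> bool" where
  "walk_in R = successively (\<lambda>u v. (u, v) \<in> R)"

text \<open>Single vertices and (traversed back and forth) single edges count as closed paths, so that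
  a longest closed path always exists.\<close>

definition closed_path :: "('a \<times> 'a) set \<Rightarrow> 'a list \<Rightarrow> bool" where
  "closed_path R p \<longleftrightarrow> p \<noteq> [] \<and> distinct p \<and> walk_in R p \<and>
     (length p = 1 \<or> (last p, hd p) \<in> R)"

lemma walk_in_append:
  "walk_in R (xs @ ys) \<longleftrightarrow>
     walk_in R xs \<and> walk_in R ys \<and> (xs = [] \<or> ys = [] \<or> (last xs, hd ys) \<in> R)"
  by (auto simp: walk_in_def successively_append_iff)

lemma walk_in_simps [simp]: "walk_in R []" "walk_in R [x]"
  by (auto simp: walk_in_def)

lemma walk_in_rev: "sym R \<Longrightarrow> walk_in R (rev xs) \<longleftrightarrow> walk_in R xs"
  by (simp add: walk_in_def sym_conv_converse_eq set_eq_iff)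

lemma walk_in_nth: "walk_in R xs \<Longrightarrow> Suc i < length xs \<Longrightarrow> (xs ! i, xs ! Suc i) \<in> R"
  by (simp add: walk_in_def successively_conv_nth)

lemma walk_in_mono: "walk_in Q xs \<Longrightarrow> Q \<subseteq> R \<Longrightarrow> walk_in R xs"
  unfolding walk_in_def by (erule successively_mono) auto

lemma closed_path_rotate: "closed_path R p \<Longrightarrow> closed_path R (rotate k p)"
proof (induction k)
  case (Suc k)
  obtain x xs where eq: "rotate k p = x # xs"
    using Suc by (cases "rotate k p") (auto simp: closed_path_def)
  have "closed_path R (xs @ [x])"
    using Suc eq walk_in_append[of R "[x]" xs]
    by (cases "xs = []") (auto simp: closed_path_def walk_in_append)
  then show ?case by (simp add: eq)
qed simp

lemma split_list_at:
  assumes "0 < i" "i < length w"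
  obtains xs ys where "w = xs @ ys" "xs \<noteq> []" "ys \<noteq> []" "length xs = i" "hd xs = hd w"
    "last xs = w ! (i - 1)" "hd ys = w ! i" "last ys = last w"
proof (rule that[of "take i w" "drop i w"])
  show "last (take i w) = w ! (i - 1)"
    using assms by (subst last_conv_nth) auto
qed (use assms in \<open>auto simp: hd_drop_conv_nth\<close>)

text \<open>Whether rearranged segments form a cycle depends only on the ends of the segments, so
  the cuts record these ends by position.\<close>

lemma split_list_at2:
  assumes "0 < i" "i < j" "j < length w"
  obtains xs ys zs where "w = xs @ ys @ zs" "xs \<noteq> []" "ys \<noteq> []" "zs \<noteq> []"
    "hd xs = hd w" "last xs = w ! (i - 1)" "hd ys = w ! i" "last ys = w ! (j - 1)"
    "hd zs = w ! j" "last zs = last w" "length xs = i" "length ys = j - i"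
proof -
  have "i < length w" using assms by simp
  then obtain xs us where 1: "w = xs @ us" "xs \<noteq> []" "us \<noteq> []" "length xs = i" "hd xs = hd w"
    "last xs = w ! (i - 1)" "hd us = w ! i" "last us = last w"
    using split_list_at assms(1) by metis
  have "0 < j - i" "j - i < length us" using assms 1 by auto
  then obtain ys zs where 2: "us = ys @ zs" "ys \<noteq> []" "zs \<noteq> []" "length ys = j - i" "hd ys = hd us"
    "last ys = us ! (j - i - 1)" "hd zs = us ! (j - i)" "last zs = last us"
    using split_list_at by metis
  have nth: "us ! k = w ! (i + k)" for k
    using 1(4) nth_append_length_plus[of xs us k] by (simp add: 1(1))
  have "last ys = w ! (j - 1)" "hd zs = w ! j"
    using 2(6,7) nth assms(2) by simp_all
  moreover have "w = xs @ ys @ zs" "hd ys = w ! i" "last zs = last w"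
    using 1(1,7,8) 2(1,5,8) by simp_all
  ultimately show thesis
    using that 1(2,4,5,6) 2(2,3,4) by blast
qed

text \<open>When the walk returns to a vertex of the path, the path is cut off there. The bound on
  \<open>set p\<close> later keeps detours away from the longest closed path.\<close>

lemma rtrancl_path:
  assumes "(u, v) \<in> Q\<^sup>*"
  shows "\<exists>p. p \<noteq> [] \<and> distinct p \<and> walk_in Q p \<and> hd p = u \<and> last p = v \<and>
    set p \<subseteq> insert u (Range Q)"
  using assms
proof (induction rule: rtrancl_induct)
  case base
  show ?case by (rule exI[of _ "[u]"]) simp
next
  case (step y z)
  then obtain p where p: "p \<noteq> []" "distinct p" "walk_in Q p" "hd p = u" "last p = y"
    "set p \<subseteq> insert u (Range Q)" by blast
  show ?case
  proof (cases "z \<in> set p")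
    case True
    then obtain q r where "p = q @ z # r" by (meson split_list)
    then have "p = (q @ [z]) @ r" by simp
    with p show ?thesis
      by (intro exI[of _ "q @ [z]"]) (auto simp: walk_in_append hd_append split: if_splits)
  next
    case False
    with p step show ?thesis
      by (intro exI[of _ "p @ [z]"]) (auto simp: walk_in_append)
  qed
qed

lemma Suc_mod_inj: "i < l \<Longrightarrow> j < l \<Longrightarrow> Suc i mod l = Suc j mod l \<Longrightarrow> i = j"
  by (auto simp: mod_Suc split: if_splits)

section \<open>Graphs as symmetric relations: degrees and edge counts\<close>

text \<open>With ordered pairs, \<open>card R\<close> is the degree sum, and adding an edge means
  inserting two pairs.\<close>

locale rel_graph =
  fixes V :: "'a set" and R :: "('a \<times> 'a) set"
  assumes finV: "finite V" and R_sub: "R \<subseteq> V \<times> V" and symR: "sym R" and irreflR: "irrefl R"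
begin

abbreviation nbs :: "'a \<Rightarrow> 'a set" where "nbs v \<equiv> R `` {v}"
abbreviation deg :: "'a \<Rightarrow> nat" where "deg v \<equiv> card (nbs v)"

text \<open>Since \<open>closed_path\<close> admits one or two vertices, this is the usual notion
  only from three vertices on.\<close>

definition ham :: bool where "ham \<longleftrightarrow> (\<exists>p. closed_path R p \<and> set p = V)"

lemma finR: "finite R"
  using finV R_sub by (meson finite_SigmaI finite_subset)

lemma nbs_sub: "nbs v \<subseteq> V - {v}"
  using R_sub irreflR by (auto simp: irrefl_def)

lemma fin_nbs: "finite (nbs v)"
  using finite_subset[OF nbs_sub] finV by blast

lemma symI: "(u, v) \<in> R \<Longrightarrow> (v, u) \<in> R"
  using symR by (rule symD)

lemma not_refl: "(u, u) \<notin> R"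
  using irreflR by (auto simp: irrefl_def)

lemma card_R: "card R = (\<Sum>v\<in>V. deg v)"
proof -
  have "R = Sigma V nbs" using R_sub by auto
  then show ?thesis using finV fin_nbs by (metis card_SigmaI)
qed

lemma card_rel_between: "D \<subseteq> V \<Longrightarrow> card (R \<inter> D \<times> V) = (\<Sum>v\<in>D. deg v)"
proof -
  assume D: "D \<subseteq> V"
  have "R \<inter> D \<times> V = Sigma D nbs" using R_sub by auto
  then show ?thesis using finite_subset[OF D finV] fin_nbs by simp
qed

text \<open>Delete a vertex from each edge inside \<open>D\<close>.\<close>

lemma independent_subset:
  assumes "finite D"
  shows "\<exists>I\<subseteq>D. R \<inter> I \<times> I = {} \<and> 2 * card D \<le> 2 * card I + card (R \<inter> D \<times> D)"
  using assms
proof (induction "card D" arbitrary: D)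
  case 0
  then show ?case by (intro exI[of _ "{}"]) auto
next
  case (Suc k)
  show ?case
  proof (cases "R \<inter> D \<times> D = {}")
    case True
    then show ?thesis by (intro exI[of _ D]) auto
  next
    case False
    then obtain u v where uv: "u \<in> D" "v \<in> D" "(u, v) \<in> R" by blast
    have "card (D - {u}) = k" "finite (D - {u})" using Suc uv by auto
    then obtain I where I: "I \<subseteq> D - {u}" "R \<inter> I \<times> I = {}"
      "2 * card (D - {u}) \<le> 2 * card I + card (R \<inter> (D - {u}) \<times> (D - {u}))"
      using Suc.hyps by metis
    have ne: "u \<noteq> v" using uv not_refl by auto
    have sub: "(R \<inter> (D - {u}) \<times> (D - {u})) \<union> {(u, v), (v, u)} \<subseteq> R \<inter> D \<times> D"
      using uv symI by auto
    have "card ((R \<inter> (D - {u}) \<times> (D - {u})) \<union> {(u, v), (v, u)}) =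
        card (R \<inter> (D - {u}) \<times> (D - {u})) + 2"
      using finR ne by (subst card_Un_disjoint) auto
    then have "card (R \<inter> (D - {u}) \<times> (D - {u})) + 2 \<le> card (R \<inter> D \<times> D)"
      using card_mono[OF _ sub] finR by simp
    then show ?thesis using I Suc.hyps(2) \<open>card (D - {u}) = k\<close> by (intro exI[of _ I]) auto
  qed
qed

lemma card_rel_square: "finite X \<Longrightarrow> card (R \<inter> X \<times> X) \<le> card X * (card X - 1)"
proof -
  assume X: "finite X"
  have "R \<inter> X \<times> X \<subseteq> Sigma X (\<lambda>x. X - {x})" using not_refl by auto
  then have "card (R \<inter> X \<times> X) \<le> card (Sigma X (\<lambda>x. X - {x}))"
    using X by (intro card_mono) auto
  also have "\<dots> = (\<Sum>x\<in>X. card X - 1)" using X by simp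
  finally show ?thesis by simp
qed

text \<open>Pairs meeting \<open>D\<close> start or end in \<open>D\<close>. Each kind is counted by
  the degree sum over \<open>D\<close>, and the pairs inside \<open>D\<close> are of both kinds, so
  every edge inside \<open>D\<close> improves the bound.\<close>

lemma card_rel_bound:
  assumes D: "D \<subseteq> V" and deg: "\<And>v. v \<in> D \<Longrightarrow> deg v \<le> i"
  shows "card R + card (R \<inter> D \<times> D) \<le>
    (card V - card D) * (card V - card D - 1) + 2 * (card D * i)"
proof -
  let ?X = "R \<inter> D \<times> V" and ?Y = "R \<inter> V \<times> D"
  have fD: "finite D" using D finV finite_subset by blast
  have "?Y = ?X\<inverse>" using symI R_sub by auto
  then have cY: "card ?Y = card ?X" by (simp add: card_inverse)
  have "R = (R \<inter> (V - D) \<times> (V - D)) \<union> (?X \<union> ?Y)" using R_sub by auto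
  then have "card R \<le> card (R \<inter> (V - D) \<times> (V - D)) + card (?X \<union> ?Y)"
    by (metis card_Un_le)
  moreover have "card (?X \<union> ?Y) + card (?X \<inter> ?Y) = card ?X + card ?Y"
    using finR by (intro card_Un_Int[symmetric]) auto
  moreover have "?X \<inter> ?Y = R \<inter> D \<times> D" using D by auto
  moreover have "card ?X \<le> card D * i"
    using card_rel_between[OF D] sum_bounded_above[of D deg i] deg by simp
  moreover have "card (R \<inter> (V - D) \<times> (V - D)) \<le> card (V - D) * (card (V - D) - 1)"
    by (rule card_rel_square) (use finV in auto)
  moreover have "card (V - D) = card V - card D" using D fD card_Diff_subset by blast
  ultimately show ?thesis using cY by simp
qed

section \<open>Closing a path to a cycle by chords\<close>

lemma cross_closed:
  assumes "walk_in R (xs @ ys)" "distinct (xs @ ys)" "xs \<noteq> []" "ys \<noteq> []"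
    "(hd xs, hd ys) \<in> R" "(last xs, last ys) \<in> R"
  shows "closed_path R (xs @ rev ys)"
  using assms by (auto simp: closed_path_def walk_in_append walk_in_rev[OF symR] hd_rev last_rev intro: symI)

text \<open>Here and in the next two lemmas, a chord at \<open>hd xs\<close>, a chord at
  \<open>last zs\<close> and a chord between inner segment ends replace the two edges that were cut.
  Given the first two chords on a spanning path, the third is impossible in a non-Hamiltonian
  graph.\<close>

lemma cross_closed1:
  assumes "walk_in R (xs @ ys @ zs)" "distinct (xs @ ys @ zs)" "xs \<noteq> []" "ys \<noteq> []" "zs \<noteq> []"
    "(hd xs, hd ys) \<in> R" "(last zs, last ys) \<in> R" "(last xs, hd zs) \<in> R"
  shows "closed_path R (xs @ zs @ rev ys)"
  using assms by (auto simp: closed_path_def walk_in_append walk_in_rev[OF symR] hd_rev last_rev intro: symI)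

lemma cross_closed2:
  assumes "walk_in R (xs @ ys @ zs)" "distinct (xs @ ys @ zs)" "xs \<noteq> []" "ys \<noteq> []" "zs \<noteq> []"
    "(last zs, hd ys) \<in> R" "(hd xs, hd zs) \<in> R" "(last xs, last ys) \<in> R"
  shows "closed_path R (xs @ rev ys @ rev zs)"
  using assms by (auto simp: closed_path_def walk_in_append walk_in_rev[OF symR] hd_rev last_rev intro: symI)

lemma cross_closed3:
  assumes "walk_in R (xs @ ys @ zs)" "distinct (xs @ ys @ zs)" "xs \<noteq> []" "ys \<noteq> []" "zs \<noteq> []"
    "(last zs, last xs) \<in> R" "(hd xs, last ys) \<in> R" "(hd ys, hd zs) \<in> R"
  shows "closed_path R (xs @ rev zs @ ys)"
  using assms by (auto simp: closed_path_def walk_in_append walk_in_rev[OF symR] hd_rev last_rev intro: symI)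

section \<open>Cycles of every length\<close>

text \<open>The map \<open>f\<close> below sends a neighbour position of \<open>hd q\<close> to the position which, if adjacent to
  \<open>last q\<close>, would close a cycle of length \<open>r\<close>.\<close>

lemma deg_sum_if_no_cycle:
  assumes q: "closed_path R q" "set q = V" and r: "3 \<le> r" "r < length q"
    and no: "\<And>p. closed_path R p \<Longrightarrow> set p \<subseteq> V \<Longrightarrow> length p \<noteq> r"
  shows "deg (hd q) + deg (last q) \<le> length q"
proof -
  define n where "n = length q"
  define x where "x = hd q"
  define y where "y = last q"
  have rn: "3 \<le> r" "r < n" using r by (auto simp: n_def)
  have qq: "distinct q" "walk_in R q" "q \<noteq> []" "(y, x) \<in> R"
    using q r by (auto simp: closed_path_def x_def y_def)
  have x0: "x = q ! 0" and yn: "y = q ! (n - 1)"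
    using qq(3) by (simp_all add: x_def y_def n_def hd_conv_nth last_conv_nth)
  \<comment> \<open>Position 1 is left out to keep \<open>f\<close> injective: its image would be r
    - 2, which is already the image of n - 1. This costs the 1 in
    \<open>deg x \<le> card K + 1\<close>.\<close>
  define K where "K = {k. 2 \<le> k \<and> k < n \<and> (x, q ! k) \<in> R}"
  define J where "J = {j. j < n - 1 \<and> (y, q ! j) \<in> R}"
  define f where "f k = (if k \<le> n - r + 1 then k + r - 3 else k + r - 1 - n)" for k
  have fin: "finite K" "finite J" by (simp_all add: K_def J_def)
  have split: "\<exists>xs ys zs. q = xs @ ys @ zs \<and> xs \<noteq> [] \<and> ys \<noteq> [] \<and> zs \<noteq> [] \<and> hd xs = x \<and>
      last xs = q ! (i - 1) \<and> hd ys = q ! i \<and> last ys = q ! (j - 1) \<and> hd zs = q ! j \<and> last zs = y \<and>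
      length xs = i \<and> length ys = j - i"
    if "0 < i" "i < j" "j < n" for i j
    using split_list_at2[of i j q] that unfolding n_def x_def y_def by metis
  have notJ: "f k \<notin> J" if k: "k \<in> K" for k
  proof
    assume fk: "f k \<in> J"
    have k2: "2 \<le> k" "k < n" "(x, q ! k) \<in> R" using k by (auto simp: K_def)
    \<comment> \<open>In the first case the cycle is x, then r - 2 consecutive vertices starting
      with \<open>q ! k\<close>, then y, closed by the edge y x. In the second case two chords
      bypass n - r consecutive vertices ending just before \<open>q ! k\<close>.\<close>
    show False
    proof (cases "k \<le> n - r + 1")
      case True
      have "0 < k" "k < k + r - 2" "k + r - 2 < n" using True k2 rn by auto
      then obtain xs ys zs where xy: "q = xs @ ys @ zs" "xs \<noteq> []" "ys \<noteq> []" "zs \<noteq> []" "hd xs = x"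
        "hd ys = q ! k" "last ys = q ! (k + r - 2 - 1)" "last zs = y" "length ys = k + r - 2 - k"
        using split[of k "k + r - 2"] by blast
      have "(y, last ys) \<in> R" using fk True xy(7) by (simp add: f_def J_def diff_diff_add)
      moreover have "(x, hd ys) \<in> R" using k2 xy(6) by simp
      moreover have "x \<in> set xs" "y \<in> set zs"
        using xy(2,4,5,8) hd_in_set last_in_set by blast+
      moreover have "walk_in R ys" "distinct (xs @ ys @ zs)"
        using qq(1,2) by (simp_all add: xy(1) walk_in_append)
      ultimately have "closed_path R (x # ys @ [y])"
        using xy(3) qq(4) walk_in_append[of R "[x]" "ys @ [y]"] symI
        by (auto simp: closed_path_def walk_in_append)
      moreover have "set (x # ys @ [y]) \<subseteq> V"
        using \<open>x \<in> set xs\<close> \<open>y \<in> set zs\<close> q(2) by (auto simp: xy(1))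
      ultimately show False using no[of "x # ys @ [y]"] xy(9) rn by auto
    next
      case False
      have *: "0 < k + r - n" "k + r - n < k" "k + r - n - 1 = k + r - 1 - n"
        using False rn by auto
      then obtain xs ys zs where xy: "q = xs @ ys @ zs" "xs \<noteq> []" "ys \<noteq> []" "zs \<noteq> []" "hd xs = x"
        "last xs = q ! (k + r - 1 - n)" "hd zs = q ! k" "last zs = y" "length xs = k + r - n"
        "length ys = k - (k + r - n)"
        using split[of "k + r - n" k] k2 by auto
      have "(last xs, y) \<in> R" using fk False xy(6) symI by (simp add: f_def J_def)
      moreover have "(hd zs, x) \<in> R" using k2 xy(7) symI by simp
      moreover have "walk_in R xs" "walk_in R zs" "distinct (xs @ ys @ zs)"
        using qq(1,2) by (simp_all add: xy(1) walk_in_append)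
      ultimately have "closed_path R (xs @ rev zs)"
        using xy(2,4,5,8)
        by (auto simp: closed_path_def walk_in_append walk_in_rev[OF symR] hd_rev last_rev)
      moreover have "set (xs @ rev zs) \<subseteq> V" using q(2) by (auto simp: xy(1))
      moreover have "length xs + length ys + length zs = n" by (simp add: n_def xy(1))
      then have "length (xs @ rev zs) = r" using xy(9,10) False k2 rn by simp
      ultimately show False using no by blast
    qed
  qed
  have inj: "inj_on f K"
  proof (rule inj_onI)
    fix k k' assume "k \<in> K" "k' \<in> K" "f k = f k'"
    then show "k = k'" using rn by (auto simp: K_def f_def split: if_splits)
  qed
  have "f ` K \<subseteq> {..<n - 1}" using rn by (auto simp: K_def f_def)
  moreover have "J \<subseteq> {..<n - 1}" by (auto simp: J_def)
  ultimately have "card (f ` K \<union> J) \<le> card {..<n - 1}" by (intro card_mono) auto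
  moreover have "card (f ` K \<union> J) = card K + card J"
    using notJ fin inj by (subst card_Un_disjoint) (auto simp: card_image)
  ultimately have KJ: "card K + card J \<le> n - 1" by simp
  have "nbs x \<subseteq> insert (q ! 1) ((!) q ` K)"
  proof
    fix v assume v: "v \<in> nbs x"
    then have "v \<in> V" "v \<noteq> x" using nbs_sub by auto
    then obtain k where k: "k < n" "v = q ! k" using q(2) by (auto simp: n_def in_set_conv_nth)
    then have "k \<noteq> 0" using \<open>v \<noteq> x\<close> x0 by (cases k) auto
    then consider "k = 1" | "2 \<le> k" by linarith
    then show "v \<in> insert (q ! 1) ((!) q ` K)" using k v by cases (auto simp: K_def)
  qed
  then have "deg x \<le> card (insert (q ! 1) ((!) q ` K))" using fin by (intro card_mono) auto
  also have "\<dots> \<le> card K + 1"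
    using card_insert_le_m1[of "Suc (card K)" "(!) q ` K" "q ! 1"] card_image_le[OF fin(1), of "(!) q"] by simp
  finally have dx: "deg x \<le> card K + 1" .
  have "nbs y \<subseteq> (!) q ` J"
  proof
    fix v assume v: "v \<in> nbs y"
    then have "v \<in> V" "v \<noteq> y" using nbs_sub by auto
    then obtain k where k: "k < n" "v = q ! k" using q(2) by (auto simp: n_def in_set_conv_nth)
    then have "k \<noteq> n - 1" using \<open>v \<noteq> y\<close> yn by auto
    then have "k < n - 1" using k by simp
    then show "v \<in> (!) q ` J" using k v by (auto simp: J_def)
  qed
  then have "deg y \<le> card ((!) q ` J)" using fin by (intro card_mono) auto
  then have dy: "deg y \<le> card J" using card_image_le[OF fin(2), of "(!) q"] by linarith
  show ?thesis using dx dy KJ rn unfolding x_def y_def n_def by linarith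
qed

text \<open>Bondy's theorem: more than \<open>n\<^sup>2/4\<close> edges make a Hamiltonian graph pancyclic.\<close>

lemma closed_path_of_length:
  assumes h: "ham" and many: "card V * card V < 2 * card R" and r: "3 \<le> r" "r < card V"
  shows "\<exists>p. closed_path R p \<and> set p \<subseteq> V \<and> length p = r"
proof (rule ccontr)
  assume no: "\<not> ?thesis"
  obtain p where p: "closed_path R p" "set p = V" using h by (auto simp: ham_def)
  define n where "n = length p"
  have pd: "distinct p" "p \<noteq> []" using p by (auto simp: closed_path_def)
  have n: "n = card V" using p pd by (auto simp: n_def distinct_card)
  have n0: "n > 0" using pd by (simp add: n_def)
  \<comment> \<open>Rotation brings any two consecutive vertices of the cycle to the ends of the
    list. Summed over the whole cycle, every degree occurs twice.\<close>
  have le: "deg (p ! (Suc j mod n)) + deg (p ! j) \<le> n" if j: "j < n" for j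
  proof -
    have "Suc j + (n - 1) = j + n" using n0 by linarith
    then have "(Suc j + (n - 1)) mod n = j" using j by simp
    then have "last (rotate (Suc j) p) = p ! j"
      using pd(2) n0 nth_rotate[of "n - 1" p "Suc j"]
      by (simp add: last_conv_nth n_def del: rotate_Suc)
    moreover have "hd (rotate (Suc j) p) = p ! (Suc j mod n)"
      using hd_rotate_conv_nth[OF pd(2)] n_def by blast
    ultimately show ?thesis
      using deg_sum_if_no_cycle[of "rotate (Suc j) p" r] closed_path_rotate[OF p(1)] p(2) r no
      by (auto simp: n n_def[symmetric] simp del: rotate_Suc)
  qed
  have b1: "bij_betw ((!) p) {..<n} V"
    using pd(1) p(2) by (simp add: bij_betw_nth n_def)
  have "inj_on (\<lambda>j. Suc j mod n) {..<n}"
    by (intro inj_onI) (auto intro: Suc_mod_inj)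
  moreover have "(\<lambda>j. Suc j mod n) ` {..<n} \<subseteq> {..<n}" using n0 by auto
  ultimately have b2: "bij_betw (\<lambda>j. Suc j mod n) {..<n} {..<n}"
    by (simp add: bij_betw_def endo_inj_surj)
  have s1: "(\<Sum>j<n. deg (p ! j)) = card R"
    using sum.reindex_bij_betw[OF b1, of deg] card_R by simp
  then have s2: "(\<Sum>j<n. deg (p ! (Suc j mod n))) = card R"
    using sum.reindex_bij_betw[OF b2, of "\<lambda>j. deg (p ! j)"] by simp
  have "(\<Sum>j<n. deg (p ! (Suc j mod n)) + deg (p ! j)) \<le> (\<Sum>j<n. n)"
    using le by (intro sum_mono) auto
  then show False using s1 s2 many by (simp add: sum.distrib n)
qed

end

section \<open>Toughness as a separation property\<close>

text \<open>Toughness without components: the vertices of \<open>T\<close> lie in different components of the graph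
  minus \<open>S\<close>, each separated from the others by a set \<open>X\<close>. In this form toughness obviously passes to
  graphs with more edges.\<close>

locale tough_graph = rel_graph +
  fixes t :: real
  assumes t_ge: "t \<ge> 4"
    and sep: "\<And>S T. S \<subseteq> V \<Longrightarrow> T \<subseteq> V - S \<Longrightarrow> card T \<ge> 2 \<Longrightarrow>
      (\<And>u. u \<in> T \<Longrightarrow> \<exists>X. u \<in> X \<and> X \<inter> T = {u} \<and>
         (\<forall>a\<in>X. \<forall>b. (a, b) \<in> R \<longrightarrow> b \<notin> S \<longrightarrow> b \<in> X)) \<Longrightarrow>
      t * real (card T) \<le> real (card S)"
begin

text \<open>One closed set separates both vertices: by symmetry of \<open>R\<close>, the complement
  of \<open>X \<union> S\<close> is closed as well.\<close>

lemma sep_pair: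
  assumes S: "S \<subseteq> V" and u: "u \<in> V - S" "u \<in> X" and v: "v \<in> V - S" "v \<notin> X"
    and X: "\<And>a b. a \<in> X \<Longrightarrow> (a, b) \<in> R \<Longrightarrow> b \<notin> S \<Longrightarrow> b \<in> X"
  shows "2 * t \<le> card S"
proof -
  have ne: "u \<noteq> v" using u v by auto
  have "t * real (card {u, v}) \<le> card S"
  proof (rule sep[OF S])
    fix c assume "c \<in> {u, v}"
    then consider "c = u" | "c = v" by blast
    then show "\<exists>X. c \<in> X \<and> X \<inter> {u, v} = {c} \<and>
        (\<forall>a\<in>X. \<forall>b. (a, b) \<in> R \<longrightarrow> b \<notin> S \<longrightarrow> b \<in> X)"
    proof cases
      case 1
      then show ?thesis using u v X by (intro exI[of _ X]) auto
    next
      case 2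
      then show ?thesis using u v X symI by (intro exI[of _ "- (X \<union> S)"]) auto
    qed
  qed (use u v ne in auto)
  then show ?thesis using ne by simp
qed

text \<open>Outside \<open>S\<close> each vertex of \<open>I\<close> is a component of its own, and
  \<open>z\<close> lies in a further one.\<close>

lemma sep_isolated:
  assumes I: "I \<subseteq> V" "I \<noteq> {}" "I \<inter> S = {}" "\<And>v. v \<in> I \<Longrightarrow> nbs v \<subseteq> S"
    and S: "S \<subseteq> V" and z: "z \<in> V" "z \<notin> I" "z \<notin> S"
  shows "t * (real (card I) + 1) \<le> card S"
proof -
  have fI: "finite I" using I finV finite_subset by blast
  then have pos: "card I \<ge> 1" using I by (simp add: Suc_leI card_gt_0_iff)
  have "t * real (card (insert z I)) \<le> card S"
  proof (rule sep[OF S])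
    show "insert z I \<subseteq> V - S" using I z by auto
    show "2 \<le> card (insert z I)" using fI z pos by simp
    fix c assume "c \<in> insert z I"
    then consider "c = z" | "c \<in> I" by blast
    then show "\<exists>X. c \<in> X \<and> X \<inter> insert z I = {c} \<and>
        (\<forall>a\<in>X. \<forall>b. (a, b) \<in> R \<longrightarrow> b \<notin> S \<longrightarrow> b \<in> X)"
    proof cases
      case 1
      have "b \<notin> I" if "a \<notin> S" "(a, b) \<in> R" for a b using I(4)[of b] symI[OF that(2)] that(1) by blast
      then show ?thesis using 1 z by (intro exI[of _ "- (I \<union> S)"]) blast
    next
      case 2
      then show ?thesis using I z by (intro exI[of _ "{c}"]) auto
    qed
  qed
  then show ?thesis using fI z by (simp add: add.commute)
qed

text \<open>Deleting \<open>nbs v\<close> isolates \<open>v\<close> from \<open>z\<close>.\<close>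

lemma min_degree:
  assumes "v \<in> V" "z \<in> V" "z \<noteq> v" "(v, z) \<notin> R"
  shows "2 * t \<le> deg v"
  using sep_isolated[of "{v}" "nbs v" z] assms nbs_sub[of v] by (auto simp: mult.commute)

text \<open>Deleting \<open>V - I\<close> leaves the vertices of \<open>I\<close> isolated; one of
  them serves as the further vertex of \<open>sep_isolated\<close>.\<close>

lemma independent_card:
  assumes I: "I \<subseteq> V" "R \<inter> I \<times> I = {}" "card I \<ge> 2"
  shows "(t + 1) * card I \<le> card V"
proof -
  obtain z where z: "z \<in> I" using I by fastforce
  have fI: "finite I" using I finV finite_subset by blast
  have cz: "real (card (I - {z})) = real (card I) - 1"
    using z fI I(3) by (simp add: of_nat_diff)
  have "I - {z} \<noteq> {}"
    using cz I(3) by (metis card.empty diff_gt_0_iff_gt less_irrefl of_nat_0 of_nat_1 of_nat_less_iff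
        one_less_numeral_iff order_less_le_trans semiring_norm(76))
  then have "t * (real (card (I - {z})) + 1) \<le> card (V - I)"
    by (rule sep_isolated[rotated, where z = z]) (use I z R_sub in auto)
  moreover have "real (card (V - I)) = real (card V) - real (card I)"
    using I fI by (simp add: card_Diff_subset card_mono finV of_nat_diff)
  ultimately show ?thesis using cz by (simp add: algebra_simps)
qed

section \<open>Order of a non-Hamiltonian tough graph\<close>

text \<open>The argument of Chvatal and Erdos: if \<open>H\<close> is a component outside a longest closed path, the
  successors on the path of the neighbours of \<open>H\<close>, together with one vertex of \<open>H\<close>, are
  independent.\<close>

lemma card_ge_if_not_ham:
  assumes nh: "\<not> ham" and ne: "V \<noteq> {}"
  shows "(2 * t + 1) * (t + 1) \<le> card V"
proof -
  let ?P = "\<lambda>p. closed_path R p \<and> set p \<subseteq> V"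
  obtain v0 where "v0 \<in> V" using ne by blast
  then have "?P [v0]" by (simp add: closed_path_def)
  moreover have "\<forall>q. ?P q \<longrightarrow> length q < Suc (card V)"
    using finV by (metis less_Suc_eq_le card_mono closed_path_def distinct_card)
  ultimately obtain p where p: "closed_path R p" "set p \<subseteq> V"
    and longest: "\<And>q. closed_path R q \<Longrightarrow> set q \<subseteq> V \<Longrightarrow> length q \<le> length p"
    using ex_has_greatest_nat[of ?P "[v0]" length "Suc (card V)"] by blast
  define C where "C = set p"
  define l where "l = length p"
  have pd: "p \<noteq> []" "distinct p" "walk_in R p" "l = 1 \<or> (last p, hd p) \<in> R"
    using p(1) by (auto simp: closed_path_def l_def)
  have l0: "l > 0" using pd by (simp add: l_def)
  obtain h where h: "h \<in> V" "h \<notin> C" using nh p C_def unfolding ham_def by blast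
  \<comment> \<open>\<open>H\<close> is the component of \<open>h\<close> outside the closed path,
    \<open>A\<close> its set of attachment vertices, \<open>J\<close> their positions, and
    \<open>\<sigma>\<close> the cyclic successor.\<close>
  define Q where "Q = R \<inter> (V - C) \<times> (V - C)"
  define H where "H = {v. (h, v) \<in> Q\<^sup>*}"
  define A where "A = {c \<in> C. \<exists>u\<in>H. (c, u) \<in> R}"
  define J where "J = {i. i < l \<and> p ! i \<in> A}"
  define \<sigma> where "\<sigma> i = p ! (Suc i mod l)" for i
  have hH: "h \<in> H" by (simp add: H_def)
  have symQ: "sym Q" using symR by (auto simp: Q_def sym_def)
  have HV: "v \<in> V - C" if "v \<in> H" for v
    using that h unfolding H_def Q_def by (auto elim: rtranclE)
  have Hclosed: "b \<in> H" if "a \<in> H" "(a, b) \<in> R" "b \<notin> C" for a b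
    using that HV[OF that(1)] R_sub unfolding H_def Q_def
    by (auto intro: rtrancl_into_rtrancl)
  have bridge: "\<exists>P. P \<noteq> [] \<and> distinct P \<and> walk_in R P \<and> set P \<subseteq> V \<and> set P \<inter> C = {} \<and>
      (a, hd P) \<in> R \<and> (last P, b) \<in> R" if ab: "a \<in> A" "b \<in> A" for a b
  proof -
    obtain u v where uv: "u \<in> H" "(a, u) \<in> R" "v \<in> H" "(b, v) \<in> R"
      using ab by (auto simp: A_def)
    have "(u, h) \<in> Q\<^sup>*" using uv symQ by (metis H_def mem_Collect_eq sym_rtrancl symD)
    then have "(u, v) \<in> Q\<^sup>*" using uv by (auto simp: H_def)
    then obtain P where P: "P \<noteq> []" "distinct P" "walk_in Q P" "hd P = u" "last P = v"
      "set P \<subseteq> insert u (Range Q)"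
      using rtrancl_path by metis
    have "set P \<subseteq> V - C" using P(6) HV[OF uv(1)] by (auto simp: Q_def)
    moreover have "walk_in R P" using P(3) by (rule walk_in_mono) (auto simp: Q_def)
    ultimately show ?thesis using P uv symI by (intro exI[of _ P]) auto
  qed
  \<comment> \<open>Otherwise a detour through \<open>H\<close> replaces the edge from
    \<open>p ! i\<close> to its successor, which may be the closing edge, and yields a longer closed
    path.\<close>
  have fact1: "\<sigma> i \<notin> A" if i: "i \<in> J" for i
  proof
    assume "\<sigma> i \<in> A"
    then obtain P where P: "P \<noteq> []" "distinct P" "walk_in R P" "set P \<subseteq> V" "set P \<inter> C = {}"
        "(p ! i, hd P) \<in> R" "(last P, \<sigma> i) \<in> R"
      using bridge[of "p ! i" "\<sigma> i"] i by (auto simp: J_def)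
    show False
    proof (cases "Suc i < l")
      case True
      then obtain xs ys where xy: "p = xs @ ys" "xs \<noteq> []" "ys \<noteq> []" "length xs = Suc i"
        "hd xs = hd p" "last xs = p ! (Suc i - 1)" "hd ys = p ! Suc i" "last ys = last p"
        unfolding l_def by (rule split_list_at[OF zero_less_Suc])
      have "(last ys, hd xs) \<in> R" "(last xs, hd P) \<in> R" "(last P, hd ys) \<in> R"
        using pd(4) True P(6,7) xy(5-8) by (simp_all add: \<sigma>_def)
      then have "closed_path R (xs @ P @ ys)"
        using pd(2,3) P(1-3,5) xy(2,3) unfolding closed_path_def xy(1) C_def
        by (auto simp: walk_in_append)
      then show False using longest[of "xs @ P @ ys"] P p(2) xy(1) by auto
    next
      case False
      then have "l = Suc i" using i by (auto simp: J_def)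
      then have "last p = p ! i" "\<sigma> i = hd p"
        using pd(1) by (auto simp: last_conv_nth hd_conv_nth \<sigma>_def l_def)
      then have "closed_path R (p @ P)"
        using pd P by (auto simp: closed_path_def walk_in_append C_def)
      then show False using longest[of "p @ P"] P p(2) by auto
    qed
  qed
  \<comment> \<open>Otherwise the segment from \<open>\<sigma> i\<close> to \<open>p ! j\<close> can
    be reversed: a bridge through \<open>H\<close> joins \<open>p ! i\<close> to
    \<open>p ! j\<close>, and the assumed edge joins \<open>\<sigma> i\<close> to
    \<open>\<sigma> j\<close>. The result is again longer.\<close>
  have fact2: "(\<sigma> i, \<sigma> j) \<notin> R" if ij: "i \<in> J" "j \<in> J" "i < j" for i j
  proof
    assume s: "(\<sigma> i, \<sigma> j) \<in> R"
    obtain P where P: "P \<noteq> []" "distinct P" "walk_in R P" "set P \<subseteq> V" "set P \<inter> C = {}"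
        "(p ! i, hd P) \<in> R" "(last P, p ! j) \<in> R"
      using bridge[of "p ! i" "p ! j"] ij by (auto simp: J_def)
    have lt: "Suc i < l" using ij by (auto simp: J_def)
    then have si: "\<sigma> i = p ! Suc i" by (simp add: \<sigma>_def)
    show False
    proof (cases "Suc j < l")
      case True
      obtain xs ys zs where xy: "p = xs @ ys @ zs" "xs \<noteq> []" "ys \<noteq> []" "zs \<noteq> []"
        "hd xs = hd p" "last xs = p ! (Suc i - 1)" "hd ys = p ! Suc i" "last ys = p ! (Suc j - 1)"
        "hd zs = p ! Suc j" "last zs = last p"
        using Suc_mono[OF ij(3)] True unfolding l_def by (rule split_list_at2[OF zero_less_Suc])
      have sj: "\<sigma> j = p ! Suc j" using True by (simp add: \<sigma>_def)
      have "(last zs, hd xs) \<in> R" "(last xs, hd P) \<in> R" "(last P, last ys) \<in> R"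
        "(hd ys, hd zs) \<in> R"
        using pd(4) lt P(6,7) s si sj xy(5-10) by simp_all
      then have "closed_path R (xs @ P @ rev ys @ zs)"
        using pd(2,3) P(1-3,5) xy(2-4) unfolding closed_path_def xy(1) C_def
        by (auto simp: walk_in_append walk_in_rev[OF symR] hd_rev last_rev)
      then show False using longest[of "xs @ P @ rev ys @ zs"] P p(2) xy(1) by auto
    next
      case False
      then have "l = Suc j" using ij by (auto simp: J_def)
      then have lj: "last p = p ! j" "\<sigma> j = hd p"
        using pd(1) by (auto simp: last_conv_nth hd_conv_nth \<sigma>_def l_def)
      obtain xs ys where xy: "p = xs @ ys" "xs \<noteq> []" "ys \<noteq> []" "length xs = Suc i"
        "hd xs = hd p" "last xs = p ! (Suc i - 1)" "hd ys = p ! Suc i" "last ys = last p"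
        using lt unfolding l_def by (rule split_list_at[OF zero_less_Suc])
      have "(hd ys, hd xs) \<in> R" "(last xs, hd P) \<in> R" "(last P, last ys) \<in> R"
        using lj P(6,7) s si xy(5-8) by simp_all
      then have "closed_path R (xs @ P @ rev ys)"
        using pd(2,3) P(1-3,5) xy(2-3) unfolding closed_path_def xy(1) C_def
        by (auto simp: walk_in_append walk_in_rev[OF symR] hd_rev last_rev)
      then show False using longest[of "xs @ P @ rev ys"] P p(2) xy(1) by auto
    qed
  qed
  have AC: "A \<subseteq> C" by (auto simp: A_def)
  have CV: "C \<subseteq> V" using p by (simp add: C_def)
  have \<sigma>C: "\<sigma> i \<in> C" for i using l0 by (auto simp: \<sigma>_def C_def l_def)
  have imJ: "A = (!) p ` J"
    using AC by (force simp: J_def C_def l_def in_set_conv_nth)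
  have "inj_on ((!) p) J"
    using pd(2) by (auto simp: J_def l_def inj_on_def nth_eq_iff_index_eq)
  then have cA: "card A = card J" using imJ card_image by metis
  \<comment> \<open>A vertex of the path outside \<open>A\<close> is needed so that deleting
    \<open>A\<close> separates it from \<open>h\<close>.\<close>
  have "\<exists>c. c \<in> C \<and> c \<notin> A"
  proof (cases "A = {}")
    case True
    then show ?thesis using pd(1) by (auto simp: C_def intro: hd_in_set)
  next
    case False
    then obtain i where "i \<in> J" using imJ by auto
    then show ?thesis using fact1 \<sigma>C by blast
  qed
  then obtain c where c: "c \<in> C" "c \<notin> A" by blast
  have "2 * t \<le> card A"
  proof (rule sep_pair[of A h H c])
    show "c \<notin> H" using HV c by blast
    fix a b assume "a \<in> H" "(a, b) \<in> R" "b \<notin> A"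
    then show "b \<in> H" using Hclosed symI by (auto simp: A_def)
  qed (use AC CV h c hH in auto)
  have inj: "inj_on \<sigma> J"
  proof (rule inj_onI)
    fix i j assume ij: "i \<in> J" "j \<in> J" "\<sigma> i = \<sigma> j"
    then have "Suc i mod l = Suc j mod l"
      using nth_eq_iff_index_eq[OF pd(2), of "Suc i mod l" "Suc j mod l"] l0
      unfolding \<sigma>_def by (simp flip: l_def)
    moreover have "i < l" "j < l" using ij by (simp_all add: J_def)
    ultimately show "i = j" using Suc_mod_inj by blast
  qed
  have fJ: "finite J" by (simp add: J_def)
  have hI: "h \<notin> \<sigma> ` J" using \<sigma>C h by auto
  define I where "I = insert h (\<sigma> ` J)"
  have cI: "card I = card A + 1"
    using fJ hI inj by (simp add: I_def card_image cA)
  have h\<sigma>: "(\<sigma> i, h) \<notin> R" if "i \<in> J" for i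
    using fact1[OF that] hH \<sigma>C by (auto simp: A_def)
  have \<sigma>\<sigma>: "(\<sigma> i, \<sigma> j) \<notin> R" if "i \<in> J" "j \<in> J" for i j
    using fact2[OF that] fact2[OF that(2,1)] symI not_refl
    by (metis linorder_neqE_nat)
  have "R \<inter> I \<times> I = {}"
    using h\<sigma> \<sigma>\<sigma> symI not_refl unfolding I_def by blast
  moreover have "I \<subseteq> V" using \<sigma>C CV h by (auto simp: I_def)
  moreover have "card I \<ge> 2"
    using cI \<open>2 * t \<le> card A\<close> t_ge by linarith
  ultimately have "(t + 1) * card I \<le> card V" by (intro independent_card) auto
  moreover have "(t + 1) * (2 * t + 1) \<le> (t + 1) * card I"
    using cI \<open>2 * t \<le> card A\<close> t_ge by (intro mult_left_mono) auto
  ultimately show ?thesis by (simp add: mult.commute)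
qed

section \<open>Degree sum at the ends of a Hamiltonian path\<close>

text \<open>The crossing argument alone gives n - 1. Equality would force exactly one of the two end
  adjacencies at every position, and each resulting pattern contradicts toughness.\<close>

lemma deg_sum_if_not_ham:
  assumes w: "walk_in R w" "distinct w" "set w = V" and nh: "\<not> ham"
    and n2: "length w \<ge> 2" and nadj: "(hd w, last w) \<notin> R"
  shows "deg (hd w) + deg (last w) + 2 \<le> card V"
proof (rule ccontr)
  assume big: "\<not> ?thesis"
  define n where "n = length w"
  define x where "x = hd w"
  define y where "y = last w"
  have n: "n = card V" using w by (auto simp: n_def distinct_card)
  have x0: "x = w ! 0" and yn: "y = w ! (n - 1)"
    using hd_conv_nth[of w] last_conv_nth[of w] n2 unfolding x_def y_def n_def by fastforce+
  have inj: "inj_on ((!) w) {..<n}" using w(2) by (auto simp: n_def inj_on_def nth_eq_iff_index_eq)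
  have wV: "w ! k \<in> V" if "k < n" for k using that w(3) by (auto simp: n_def)
  \<comment> \<open>The index of \<open>a\<close> is shifted so that \<open>a k\<close> and
    \<open>b k\<close> together are the two chords of \<open>cross_closed\<close>.\<close>
  define a where "a k \<longleftrightarrow> (x, w ! Suc k) \<in> R" for k
  define b where "b k \<longleftrightarrow> (y, w ! k) \<in> R" for k
  have no_cycle: "\<not> closed_path R q" if "set q = set w" for q
    using nh w(3) that unfolding ham_def by auto
  have ab: "\<not> (a k \<and> b k)" if k: "Suc k < n" for k
  proof
    assume ak: "a k \<and> b k"
    obtain xs ys where xy: "w = xs @ ys" "xs \<noteq> []" "ys \<noteq> []" "length xs = Suc k"
      "hd xs = hd w" "last xs = w ! (Suc k - 1)" "hd ys = w ! Suc k" "last ys = last w"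
      using k unfolding n_def by (rule split_list_at[OF zero_less_Suc])
    have "closed_path R (xs @ rev ys)"
      using w ak xy(2-3,5-8) unfolding a_def b_def x_def y_def
      by (intro cross_closed) (auto simp flip: xy(1) intro: symI)
    then show False using no_cycle[of "xs @ rev ys"] xy(1) by auto
  qed
  have split: "\<exists>xs ys zs. w = xs @ ys @ zs \<and> xs \<noteq> [] \<and> ys \<noteq> [] \<and> zs \<noteq> [] \<and> hd xs = x \<and>
      last xs = w ! (i - 1) \<and> hd ys = w ! i \<and> last ys = w ! (j - 1) \<and> hd zs = w ! j \<and> last zs = y"
    if "0 < i" "i < j" "j < n" for i j
    using split_list_at2[of i j w] that unfolding n_def x_def y_def by metis
  have cross1: "(w ! p, w ! q) \<notin> R" if pq: "Suc p < q" "q < n" "a p" "b (q - 1)" for p q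
  proof
    assume e: "(w ! p, w ! q) \<in> R"
    obtain xs ys zs where xy: "w = xs @ ys @ zs" "xs \<noteq> []" "ys \<noteq> []" "zs \<noteq> []" "hd xs = x"
      "last xs = w ! p" "hd ys = w ! Suc p" "last ys = w ! (q - 1)" "hd zs = w ! q" "last zs = y"
      using split[of "Suc p" q] pq by auto
    have "closed_path R (xs @ zs @ rev ys)"
      using w e pq xy(2-10) unfolding a_def b_def
      by (intro cross_closed1) (auto simp flip: xy(1))
    then show False using no_cycle[of "xs @ zs @ rev ys"] xy(1) by auto
  qed
  have cross2: "(w ! p, w ! q) \<notin> R" if pq: "p < q" "Suc q < n" "b (Suc p)" "a q" for p q
  proof
    assume e: "(w ! p, w ! q) \<in> R"
    obtain xs ys zs where xy: "w = xs @ ys @ zs" "xs \<noteq> []" "ys \<noteq> []" "zs \<noteq> []" "hd xs = x"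
      "last xs = w ! p" "hd ys = w ! Suc p" "last ys = w ! q" "hd zs = w ! Suc q" "last zs = y"
      using split[of "Suc p" "Suc q"] pq by auto
    have "closed_path R (xs @ rev ys @ rev zs)"
      using w e pq xy(2-10) unfolding a_def b_def
      by (intro cross_closed2) (auto simp flip: xy(1))
    then show False using no_cycle[of "xs @ rev ys @ rev zs"] xy(1) by auto
  qed
  have cross3: "(w ! p, w ! q) \<notin> R" if pq: "0 < p" "p < q" "q < n" "b (p - 1)" "a (q - 2)" for p q
  proof
    assume e: "(w ! p, w ! q) \<in> R"
    obtain xs ys zs where xy: "w = xs @ ys @ zs" "xs \<noteq> []" "ys \<noteq> []" "zs \<noteq> []" "hd xs = x"
      "last xs = w ! (p - 1)" "hd ys = w ! p" "last ys = w ! (q - 1)" "hd zs = w ! q" "last zs = y"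
      using split[of p q] pq by auto
    have "Suc (q - 2) = q - 1" using pq by simp
    then have "closed_path R (xs @ rev zs @ ys)"
      using w e pq xy(2-10) unfolding a_def b_def
      by (intro cross_closed3) (auto simp flip: xy(1))
    then show False using no_cycle[of "xs @ rev zs @ ys"] xy(1) by auto
  qed
  define A where "A = {k. Suc k < n \<and> a k}"
  define B where "B = {k. Suc k < n \<and> b k}"
  have "nbs x = (\<lambda>k. w ! Suc k) ` A"
  proof
    show "nbs x \<subseteq> (\<lambda>k. w ! Suc k) ` A"
    proof
      fix v assume v: "v \<in> nbs x"
      then have "v \<in> V" "v \<noteq> x" using nbs_sub by auto
      then obtain k where "k < n" "v = w ! k"
        using w(3) by (auto simp: n_def in_set_conv_nth)
      moreover from this have "k \<noteq> 0" using \<open>v \<noteq> x\<close> x0 by (cases k) auto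
      ultimately show "v \<in> (\<lambda>k. w ! Suc k) ` A"
        using v by (intro image_eqI[of _ _ "k - 1"]) (auto simp: A_def a_def)
    qed
  qed (auto simp: A_def a_def)
  moreover have "inj_on (\<lambda>k. w ! Suc k) A"
    using w(2) by (auto simp: A_def n_def inj_on_def nth_eq_iff_index_eq)
  ultimately have dx: "deg x = card A" by (simp add: card_image)
  have "nbs y = (!) w ` B"
  proof
    show "nbs y \<subseteq> (!) w ` B"
    proof
      fix v assume v: "v \<in> nbs y"
      then have "v \<in> V" "v \<noteq> y" using nbs_sub by auto
      then obtain k where k: "k < n" "v = w ! k"
        using w(3) by (auto simp: n_def in_set_conv_nth)
      then have "k \<noteq> n - 1" using \<open>v \<noteq> y\<close> yn by auto
      then have "Suc k < n" using k by simp
      then show "v \<in> (!) w ` B"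
        using v k by (intro image_eqI[of _ _ k]) (auto simp: B_def b_def)
    qed
  qed (auto simp: B_def b_def)
  moreover have "inj_on ((!) w) B" by (rule inj_on_subset[OF inj]) (auto simp: B_def)
  ultimately have dy: "deg y = card B" by (simp add: card_image)
  have AB: "A \<inter> B = {}" using ab by (auto simp: A_def B_def)
  have sub: "A \<union> B \<subseteq> {..<n - 1}" by (auto simp: A_def B_def)
  have fin: "finite A" "finite B" using sub finite_subset by auto
  have "card (A \<union> B) = card A + card B" using AB fin by (simp add: card_Un_disjoint)
  then have "card (A \<union> B) \<ge> n - 1"
    using big dx dy unfolding n x_def y_def by linarith
  then have "A \<union> B = {..<n - 1}" using sub by (intro card_seteq) auto
  then have ba: "b k \<longleftrightarrow> \<not> a k" if "Suc k < n" for k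
  proof -
    have "k \<in> A \<union> B" using that \<open>A \<union> B = {..<n - 1}\<close> by simp
    then show ?thesis using ab[OF that] by (auto simp: A_def B_def)
  qed
  have b0: "\<not> b 0" using nadj symI unfolding b_def x_def[symmetric] y_def[symmetric] x0 by auto
  have bl: "b (n - 2)"
  proof -
    have "Suc (n - 2) = n - 1" "Suc (n - 2) < n" using n2 by (auto simp: n_def)
    moreover from this have "\<not> a (n - 2)" using nadj yn by (simp add: a_def x_def y_def)
    ultimately show ?thesis using ba by blast
  qed
  \<comment> \<open>For \<open>q \<in> U\<close> the chords from y to position q - 1 and from x to
    position q + 1 turn the path without \<open>w ! q\<close> into a cycle.\<close>
  define U where "U = {q. 0 < q \<and> Suc q < n \<and> b (q - 1) \<and> a q}"
  have U: "0 < q" "Suc q < n" "b (q - 1)" "a q" "\<not> b q" "\<not> a (q - 1)" if "q \<in> U" for q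
  proof -
    show "0 < q" "Suc q < n" "b (q - 1)" "a q" using that by (auto simp: U_def)
    then show "\<not> b q" "\<not> a (q - 1)" using ba[of q] ab[of "q - 1"] by auto
  qed
  have fU: "finite U" by (rule finite_subset[of _ "{..<n}"]) (auto simp: U_def)
  show False
  proof (cases "U = {}")
    case False
    \<comment> \<open>\<open>U\<close> is independent and its neighbours lie next to it on the path, so there are too few of them.\<close>
    define W where "W = {r. r < n \<and> (Suc r \<in> U \<or> (0 < r \<and> r - 1 \<in> U))}"
    \<comment> \<open>For r < q the crossings exclude \<open>a r\<close> and
      \<open>b (Suc r)\<close>, so by \<open>ba\<close> both \<open>b r\<close> and
      \<open>a (Suc r)\<close> hold, that is, \<open>Suc r \<in> U\<close>. For r > q they exclude
      \<open>b (r - 1)\<close> and \<open>a (r - 2)\<close>, whence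
      \<open>r - 1 \<in> U\<close>.\<close>
    have nbr: "r \<in> W" if q: "q \<in> U" and r: "r < n" "(w ! q, w ! r) \<in> R" for q r
    proof -
      consider "r < q" | "q < r" using r not_refl by (metis linorder_neqE_nat)
      then show ?thesis
      proof cases
        case 1
        have "\<not> a r"
        proof
          assume "a r"
          moreover have "Suc r \<noteq> q" using U(6)[OF q] \<open>a r\<close> by auto
          ultimately show False using cross1[of r q] U[OF q] 1 symI[OF r(2)] by auto
        qed
        moreover have "\<not> b (Suc r)"
        proof
          assume "b (Suc r)"
          moreover have "Suc r \<noteq> q" using U(5)[OF q] \<open>b (Suc r)\<close> by auto
          ultimately show False using cross2[of r q] U[OF q] 1 symI[OF r(2)] by auto
        qed
        ultimately have "Suc r \<in> U"
          using 1 U[OF q] ba[of r] ba[of "Suc r"] by (auto simp: U_def)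
        then show ?thesis using r by (simp add: W_def)
      next
        case 2
        have "\<not> b (r - 1)"
        proof
          assume "b (r - 1)"
          moreover have "r \<noteq> Suc q" using U(5)[OF q] \<open>b (r - 1)\<close> by auto
          ultimately show False using cross1[of q r] U[OF q] 2 r by auto
        qed
        moreover have "\<not> a (r - 2)" using cross3[of q r] U[OF q] 2 r by auto
        moreover have "r - 1 - 1 = r - 2" "Suc (r - 1) < n" "Suc (r - 2) < n"
          using 2 r U(1)[OF q] by auto
        ultimately have "r - 1 \<in> U"
          using 2 U(1)[OF q] ba[of "r - 1"] ba[of "r - 2"] by (auto simp: U_def)
        then show ?thesis using r 2 by (simp add: W_def)
      qed
    qed
    have "W \<subseteq> (\<lambda>u. u - 1) ` U \<union> Suc ` U"
    proof
      fix r assume "r \<in> W"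
      then consider "Suc r \<in> U" | "0 < r" "r - 1 \<in> U" by (auto simp: W_def)
      then show "r \<in> (\<lambda>u. u - 1) ` U \<union> Suc ` U"
        by cases (auto intro: image_eqI[of _ _ "Suc r"] image_eqI[of _ _ "r - 1"])
    qed
    then have "card W \<le> card ((\<lambda>u. u - 1) ` U \<union> Suc ` U)"
      using fU by (intro card_mono) auto
    also have "\<dots> \<le> card U + card U"
      using card_Un_le[of "(\<lambda>u. u - 1) ` U" "Suc ` U"] card_image_le[OF fU, of "\<lambda>u. u - 1"]
        card_image_le[OF fU, of Suc] by linarith
    finally have cW: "card W \<le> 2 * card U" by simp
    \<comment> \<open>Consecutive positions are never both in \<open>U\<close>, as
      \<open>a q\<close> and \<open>\<not> a q\<close> would follow. Position 0 lies in neither set,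
      so \<open>w ! 0\<close> is the further vertex for \<open>sep_isolated\<close>.\<close>
    have UW: "U \<inter> W = {}"
    proof -
      have False if "r \<in> U" "r \<in> W" for r
        using that(2) U[OF that(1)] U[of "Suc r"] U[of "r - 1"] by (auto simp: W_def)
      then show ?thesis by blast
    qed
    have W0: "0 \<notin> W" using U(3)[of 1] b0 by (auto simp: W_def)
    have Un: "U \<subseteq> {..<n}" and Wn: "W \<subseteq> {..<n}" by (auto simp: U_def W_def)
    have n0: "0 < n" using n2 unfolding n_def by linarith
    have eqU: "card ((!) w ` U) = card U" and eqW: "card ((!) w ` W) = card W"
      using inj_on_subset[OF inj Un] inj_on_subset[OF inj Wn] card_image by auto
    have "t * (real (card ((!) w ` U)) + 1) \<le> card ((!) w ` W)"
    proof (rule sep_isolated[of _ _ "w ! 0"])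
      show "(!) w ` U \<inter> (!) w ` W = {}"
        using inj_on_image_Int[OF inj Un Wn] UW by simp
      show "w ! 0 \<notin> (!) w ` U" "w ! 0 \<notin> (!) w ` W"
        using inj_on_image_mem_iff[OF inj, of 0] Un Wn W0 U(1)[of 0] n0 by auto
      fix v assume "v \<in> (!) w ` U"
      then obtain q where q: "q \<in> U" "v = w ! q" by blast
      show "nbs v \<subseteq> (!) w ` W"
      proof
        fix z assume "z \<in> nbs v"
        then have z: "(w ! q, z) \<in> R" "z \<in> set w" using q R_sub w(3) by auto
        then obtain r where "r < n" "z = w ! r" by (auto simp: n_def in_set_conv_nth)
        then show "z \<in> (!) w ` W" using nbr[OF q(1)] z by blast
      qed
    qed (use False wV Un Wn n0 in auto)
    then have "t * (real (card U) + 1) \<le> 2 * real (card U)"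
      unfolding eqU eqW using cW by linarith
    moreover have "4 * (real (card U) + 1) \<le> t * (real (card U) + 1)"
      using t_ge by (intro mult_right_mono) auto
    ultimately show False by simp
  next
    case True
    \<comment> \<open>All neighbours of \<open>x\<close> precede all those of \<open>y\<close>, and the vertex in between is a cut vertex.\<close>
    define s where "s = (LEAST k. b k)"
    have bs: "b s" and less: "k < s \<Longrightarrow> \<not> b k" for k
      using LeastI[of b, OF bl] not_less_Least[of k b] by (auto simp: s_def)
    have s0: "0 < s" using bs b0 by (cases s) auto
    have sn: "s \<le> n - 2" using bl less by (meson linorder_not_le)
    \<comment> \<open>The first position after s where \<open>b\<close> fails would belong to
      \<open>U\<close>.\<close>
    have up: "b k" if "s \<le> k" "Suc k < n" for k
      using that
    proof (induction k rule: dec_induct)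
      case (step k)
      moreover have "Suc k \<notin> U" using True by simp
      ultimately show ?case using ba[of "Suc k"] by (auto simp: U_def)
    qed (use bs in auto)
    \<comment> \<open>No edge jumps over position s, since \<open>a p\<close> before s and
      \<open>b (q - 1)\<close> from s on would close a cycle.\<close>
    have X: "(w ! p, w ! q) \<notin> R" if "p < s" "s < q" "q < n" for p q
      using that sn less[of p] ba[of p] up[of "q - 1"] by (intro cross1) auto
    have eq: "w ! i = w ! j \<longleftrightarrow> i = j" if "i < n" "j < n" for i j
      using that w(2) by (simp add: n_def nth_eq_iff_index_eq)
    have "2 * t \<le> card {w ! s}"
    proof (rule sep_pair[of "{w ! s}" "w ! 0" "(!) w ` {..<s}" "w ! (n - 1)"])
      show "{w ! s} \<subseteq> V" "w ! 0 \<in> V - {w ! s}" "w ! (n - 1) \<in> V - {w ! s}"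
          "w ! (n - 1) \<notin> (!) w ` {..<s}"
        using wV s0 sn n2 by (auto simp: eq n_def[symmetric])
      fix c d assume cd: "c \<in> (!) w ` {..<s}" "(c, d) \<in> R" "d \<notin> {w ! s}"
      then have "d \<in> set w" using R_sub w(3) by auto
      then obtain q where "q < n" "d = w ! q" by (auto simp: n_def in_set_conv_nth)
      then show "d \<in> (!) w ` {..<s}" using cd X by (cases q s rule: linorder_cases) auto
    qed (use s0 in auto)
    then show False using t_ge by simp
  qed
qed

end

section \<open>Edge-maximal non-Hamiltonian graphs\<close>

text \<open>The cycle must use the new edge. It is rotated until that edge is the closing one;
  dropping the edge leaves a path between \<open>x\<close> and \<open>y\<close>, reversed if
  necessary.\<close>

lemma path_if_closed_path_insert:
  assumes p: "closed_path (insert (x, y) (insert (y, x) Q)) p" and n: "length p \<ge> 3"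
    and sym: "sym Q" and not: "\<And>q. set q = set p \<Longrightarrow> \<not> closed_path Q q"
  shows "\<exists>w. walk_in Q w \<and> distinct w \<and> set w = set p \<and> hd w = x \<and> last w = y"
proof -
  let ?Q = "insert (x, y) (insert (y, x) Q)"
  have "\<exists>q. closed_path ?Q q \<and> set q = set p \<and> length q = length p \<and> (last q, hd q) \<notin> Q"
  proof (cases "(last p, hd p) \<in> Q")
    case False
    then show ?thesis using p by blast
  next
    case True
    then have "\<not> walk_in Q p" using p not[of p] by (auto simp: closed_path_def)
    then obtain i where i: "Suc i < length p" "(p ! i, p ! Suc i) \<notin> Q"
      by (auto simp: walk_in_def successively_conv_nth)
    obtain xs ys where xy: "p = xs @ ys" "xs \<noteq> []" "ys \<noteq> []" "length xs = Suc i"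
      "last xs = p ! (Suc i - 1)" "hd ys = p ! Suc i"
      using i(1) by (rule split_list_at[OF zero_less_Suc])
    have "rotate (Suc i) p = ys @ xs"
      using xy(4) rotate_append[of xs ys] by (simp add: xy(1) del: rotate_Suc)
    then have "closed_path ?Q (ys @ xs)" using closed_path_rotate[OF p] by metis
    moreover have "(last (ys @ xs), hd (ys @ xs)) \<notin> Q"
      using i(2) xy(2,3,5,6) by simp
    ultimately show ?thesis using xy(1) by (intro exI[of _ "ys @ xs"]) auto
  qed
  then obtain q where q: "closed_path ?Q q" "set q = set p" "length q = length p"
    "(last q, hd q) \<notin> Q" by blast
  have d: "distinct q" "q \<noteq> []" using q(1) by (auto simp: closed_path_def)
  have "(last q, hd q) \<in> ?Q" using q(1,3) n by (auto simp: closed_path_def)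
  then have ends: "last q = x \<and> hd q = y \<or> last q = y \<and> hd q = x" using q(4) by auto
  have "walk_in Q q"
    unfolding walk_in_def successively_conv_nth
  proof (intro allI impI)
    fix i assume i: "Suc i < length q"
    have "(q ! i, q ! Suc i) \<in> ?Q"
      using q(1) i by (intro walk_in_nth) (auto simp: closed_path_def)
    \<comment> \<open>The new edge already joins the ends of \<open>q\<close>. With at least three
      vertices these are not consecutive positions, so it cannot occur a second time.\<close>
    moreover have "{q ! i, q ! Suc i} \<noteq> {x, y}"
    proof
      assume "{q ! i, q ! Suc i} = {x, y}"
      moreover have "{x, y} = {q ! 0, q ! (length q - 1)}"
        using ends d(2) by (auto simp: hd_conv_nth last_conv_nth)
      ultimately have "(!) q ` {i, Suc i} = (!) q ` {0, length q - 1}" by simp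
      moreover have "inj_on ((!) q) {..<length q}"
        using d(1) by (auto simp: inj_on_def nth_eq_iff_index_eq)
      ultimately have "{i, Suc i} = {0, length q - 1}"
        using i by (subst (asm) inj_on_image_eq_iff[of _ "{..<length q}"]) auto
      then show False using n q(3) by (auto simp: doubleton_eq_iff)
    qed
    ultimately show "(q ! i, q ! Suc i) \<in> Q" by auto
  qed
  from ends show ?thesis
  proof
    assume "last q = x \<and> hd q = y"
    with \<open>walk_in Q q\<close> show ?thesis using d q(2)
      by (intro exI[of _ "rev q"]) (auto simp: walk_in_rev[OF sym] hd_rev last_rev)
  next
    assume "last q = y \<and> hd q = x"
    with \<open>walk_in Q q\<close> show ?thesis using d q(2) by blast
  qed
qed

context tough_graph
begin

text \<open>Relations on \<open>V\<close> have bounded size, so a largest one exists. A set closed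
  under \<open>Q\<close> is closed under the smaller \<open>R\<close>, which carries the separation
  condition over.\<close>

lemma maximal_non_ham:
  assumes nh: "\<not> ham"
  obtains Q where "R \<subseteq> Q" "tough_graph V Q t" "\<not> rel_graph.ham V Q"
    "\<And>x y. x \<in> V \<Longrightarrow> y \<in> V \<Longrightarrow> x \<noteq> y \<Longrightarrow> (x, y) \<notin> Q \<Longrightarrow>
       rel_graph.ham V (insert (x, y) (insert (y, x) Q))"
proof -
  let ?P = "\<lambda>Q. R \<subseteq> Q \<and> rel_graph V Q \<and> \<not> rel_graph.ham V Q"
  have "?P R" using nh rel_graph_axioms by simp
  moreover have "\<forall>Q. ?P Q \<longrightarrow> card Q < Suc (card (V \<times> V))"
    unfolding rel_graph_def less_Suc_eq_le using finV by (meson card_mono finite_SigmaI)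
  ultimately obtain Q where Q: "?P Q" and max: "\<And>Q'. ?P Q' \<Longrightarrow> card Q' \<le> card Q"
    using ex_has_greatest_nat[of ?P R card "Suc (card (V \<times> V))"] by blast
  have "tough_graph V Q t"
  proof (intro tough_graph.intro tough_graph_axioms.intro)
    show "rel_graph V Q" using Q by simp
    fix S T assume a: "S \<subseteq> V" "T \<subseteq> V - S" "2 \<le> card T"
      "\<And>u. u \<in> T \<Longrightarrow> \<exists>X. u \<in> X \<and> X \<inter> T = {u} \<and> (\<forall>a\<in>X. \<forall>b. (a, b) \<in> Q \<longrightarrow> b \<notin> S \<longrightarrow> b \<in> X)"
    show "t * real (card T) \<le> real (card S)"
    proof (rule sep[OF a(1-3)])
      fix u assume "u \<in> T"
      then show "\<exists>X. u \<in> X \<and> X \<inter> T = {u} \<and> (\<forall>a\<in>X. \<forall>b. (a, b) \<in> R \<longrightarrow> b \<notin> S \<longrightarrow> b \<in> X)"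
        using a(4) Q by (meson subsetD)
    qed
  qed (rule t_ge)
  moreover have "rel_graph.ham V (insert (x, y) (insert (y, x) Q))"
    if "x \<in> V" "y \<in> V" "x \<noteq> y" "(x, y) \<notin> Q" for x y
  proof (rule ccontr)
    let ?Q = "insert (x, y) (insert (y, x) Q)"
    assume "\<not> rel_graph.ham V ?Q"
    moreover have "rel_graph V ?Q"
      using Q that by (auto simp: rel_graph_def sym_def irrefl_def)
    ultimately have "card ?Q \<le> card Q" using Q by (intro max) auto
    moreover have fin: "finite Q" using Q rel_graph.finR by blast
    moreover have "card Q < card ?Q" by (rule psubset_card_mono) (use fin that in auto)
    ultimately show False by simp
  qed
  ultimately show thesis using that Q by blast
qed

end

section \<open>The numerical estimate\<close>

text \<open>Twice the edge bound for a graph with \<open>j + 1\<close> vertices of degree at most \<open>j\<close>. As a function of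
  \<open>j\<close> the left-hand side is convex, so it suffices to compare at the ends of \<open>[2t, (N - 2)/2]\<close>.\<close>

lemma edge_bound_less:
  fixes N t j K :: real
  assumes t: "4 \<le> t" and N: "(2 * t + 1) * (t + 1) \<le> N" and j: "2 * t \<le> j" "2 * j + 2 \<le> N"
    and K: "(t + 1) * K \<le> N"
  shows "(N - j - 1) * (N - j - 2) + 2 * (j + 1) * (j - 1) + 2 * K
    < (N - 2 * t) * (N - 2 * t - 1) + 6 * t\<^sup>2"
proof -
  define M where "M = (N - 2) / 2"
  \<comment> \<open>In \<open>s\<close> and \<open>d\<close>, both nonnegative, the two endpoint
    estimates become polynomials with positive coefficients.\<close>
  define s where "s = t - 4"
  define d where "d = N - (2 * t + 1) * (t + 1)"
  have sd: "0 \<le> s" "0 \<le> d" using t N by (auto simp: s_def d_def)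
  have tN: "t = s + 4" "N = d + (2 * (s + 4) + 1) * (s + 5)" by (auto simp: s_def d_def algebra_simps)
  \<comment> \<open>N / (t + 1) equals 2t + 1 + d / (t + 1), and t + 1 is at least 5.\<close>
  have K2: "K \<le> 2 * t + 1 + d / 5"
  proof -
    have "5 * (d / 5) \<le> (t + 1) * (d / 5)" using t sd by (intro mult_right_mono) auto
    then have "(t + 1) * K \<le> (2 * t + 1) * (t + 1) + (t + 1) * (d / 5)"
      using K by (simp add: d_def)
    also have "\<dots> = (t + 1) * (2 * t + 1 + d / 5)" by (simp only: ring_distribs mult.commute)
    finally show ?thesis using t by simp
  qed
  define g where "g j = (N - j - 1) * (N - j - 2) + 2 * (j + 1) * (j - 1) + 2 * K
    - ((N - 2 * t) * (N - 2 * t - 1) + 6 * t\<^sup>2)" for j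
  have gL: "g (2 * t) < 0"
  proof -
    have "0 \<le> s * d" "0 \<le> s\<^sup>2" using sd by simp_all
    moreover have "N - (2 * t + 1 + d / 5) - t\<^sup>2 - 2 * t = s\<^sup>2 + 7 * s + 12 + 4 * d / 5"
      unfolding tN by (simp add: power2_eq_square field_simps)
    ultimately have "0 < N - (2 * t + 1 + d / 5) - t\<^sup>2 - 2 * t" using sd by linarith
    then show ?thesis using K2 by (simp add: g_def power2_eq_square algebra_simps)
  qed
  have gM: "g M < 0"
  proof -
    define P where "P = N\<^sup>2 / 8 - 2 * t * N + 3 * N / 4 + 5 * t\<^sup>2 + t"
    have "g M = - 2 * P + 2 * K"
      by (simp add: P_def g_def M_def power2_eq_square field_simps)
    moreover have "0 < P - (2 * t + 1 + d / 5)"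
    proof -
      have "0 \<le> s * d" "0 \<le> s\<^sup>2 * d" "0 \<le> d\<^sup>2" "0 \<le> s\<^sup>2" "0 \<le> s^3" "0 \<le> s^4" using sd by simp_all
      moreover have "P - (2 * t + 1 + d / 5) =
          d\<^sup>2 / 8 + s\<^sup>2 * d / 2 + 11 / 4 * (s * d) + 19 / 5 * d + s^4 / 2 + 11 / 2 * s^3
          + 161 / 8 * s\<^sup>2 + 25 * s + 15 / 8"
        unfolding P_def tN by (simp add: power2_eq_square power3_eq_cube power4_eq_xxxx field_simps)
      ultimately show ?thesis using sd by linarith
    qed
    ultimately show ?thesis using K2 by linarith
  qed
  \<comment> \<open>\<open>g\<close> is \<open>3 * h\<close> plus a linear function of slope
    \<open>c\<close>, and \<open>h\<close> vanishes at both ends and is at most 0 between them. The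
    sign of \<open>c\<close> decides which end bounds \<open>g j\<close>.\<close>
  define c where "c = 6 * t - N / 2"
  define h where "h k = (k - 2 * t) * (k - M)" for k
  have g_diff: "g j = g k + 3 * h j - 3 * h k + c * (j - k)" for j k
    by (simp add: g_def h_def M_def c_def power2_eq_square field_simps)
  have h: "h j \<le> 0" "h M = 0" "h (2 * t) = 0"
    using j by (auto simp: h_def M_def intro: mult_nonneg_nonpos)
  have "g j < 0"
  proof (cases "c \<ge> 0")
    case True
    then have "c * (j - M) \<le> 0" using j by (intro mult_nonneg_nonpos) (auto simp: M_def)
    then show ?thesis using g_diff[of j M] gM h by linarith
  next
    case False
    then have "c * (j - 2 * t) \<le> 0" using j by (intro mult_nonpos_nonneg) auto
    then show ?thesis using g_diff[of j "2 * t"] gL h by linarith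
  qed
  then show ?thesis by (simp add: g_def)
qed

section \<open>Many edges force a Hamiltonian cycle\<close>

context tough_graph
begin

text \<open>The edge bound appears doubled because \<open>card R\<close> counts ordered pairs. It
  suffices to bound \<open>card Q\<close> for an edge-maximal \<open>Q\<close> containing
  \<open>R\<close>.\<close>

lemma ham_if_many_edges:
  assumes ne: "V \<noteq> {}"
    and many: "(real (card V) - 2 * t) * (real (card V) - 2 * t - 1) + 6 * t\<^sup>2 \<le> card R"
  shows "ham"
proof (rule ccontr)
  assume nh: "\<not> ham"
  define n where "n = card V"
  have big: "(2 * t + 1) * (t + 1) \<le> n" using card_ge_if_not_ham[OF nh ne] by (simp add: n_def)
  have "(2 * 4 + 1) * (4 + 1) \<le> (2 * t + 1) * (t + 1)" using t_ge by (intro mult_mono) auto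
  then have n45: "n \<ge> 45" using big by simp
  obtain Q where Q: "R \<subseteq> Q" "tough_graph V Q t" "\<not> rel_graph.ham V Q"
    and max: "\<And>x y. x \<in> V \<Longrightarrow> y \<in> V \<Longrightarrow> x \<noteq> y \<Longrightarrow> (x, y) \<notin> Q \<Longrightarrow>
       rel_graph.ham V (insert (x, y) (insert (y, x) Q))"
    using maximal_non_ham[OF nh] by blast
  interpret Q: tough_graph V Q t by (rule Q(2))
  let ?N = "{(x, y). x \<in> V \<and> y \<in> V \<and> x \<noteq> y \<and> (x, y) \<notin> Q}"
  \<comment> \<open>Adding the edge creates a Hamiltonian cycle, hence \<open>Q\<close> has a
    Hamiltonian path from x to y.\<close>
  have dQ: "Q.deg x + Q.deg y + 2 \<le> n" if xy: "(x, y) \<in> ?N" for x y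
  proof -
    let ?Q = "insert (x, y) (insert (y, x) Q)"
    have rgQ: "rel_graph V ?Q"
      using Q.rel_graph_axioms xy by (auto simp: rel_graph_def sym_def irrefl_def)
    have "rel_graph.ham V ?Q" using max xy by auto
    then obtain p where p: "closed_path ?Q p" "set p = V"
      unfolding rel_graph.ham_def[OF rgQ] by blast
    then have "length p = n" by (auto simp: closed_path_def n_def distinct_card)
    then have "\<exists>w. walk_in Q w \<and> distinct w \<and> set w = set p \<and> hd w = x \<and> last w = y"
      using n45 Q(3) p by (intro path_if_closed_path_insert[OF p(1)] Q.symR) (auto simp: Q.ham_def)
    then obtain w where w: "walk_in Q w" "distinct w" "set w = V" "hd w = x" "last w = y"
      using p(2) by auto
    have "length w = n" using w by (auto simp: n_def distinct_card)
    then show ?thesis using Q.deg_sum_if_not_ham[OF w(1-3) Q(3)] w(4,5) xy n45 by (simp add: n_def)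
  qed
  have "?N \<noteq> {}"
  proof
    assume complete: "?N = {}"
    then have adj: "(u, v) \<in> Q" if "u \<in> V" "v \<in> V" "u \<noteq> v" for u v using that by blast
    obtain p where p: "set p = V" "distinct p" using finite_distinct_list[OF finV] by blast
    have len: "length p = n" using p by (auto simp: n_def distinct_card)
    have "walk_in Q p" unfolding walk_in_def successively_conv_nth
      using p adj by (auto simp: nth_eq_iff_index_eq)
    moreover have "(last p, hd p) \<in> Q"
    proof (rule adj)
      have pne: "p \<noteq> []" using p(1) ne by auto
      then show "last p \<in> V" "hd p \<in> V" using p(1) by auto
      show "last p \<noteq> hd p"
        using len n45 pne nth_eq_iff_index_eq[OF p(2), of "length p - 1" 0]
        by (simp add: hd_conv_nth last_conv_nth)
    qed
    ultimately have "closed_path Q p" using p ne by (auto simp: closed_path_def)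
    then show False using Q(3) p by (auto simp: Q.ham_def)
  qed
  then obtain z0 where "z0 \<in> ?N" by blast
  then obtain xy where xy: "xy \<in> ?N"
    and xymax: "\<And>z. z \<in> ?N \<Longrightarrow> Q.deg (fst z) + Q.deg (snd z) \<le> Q.deg (fst xy) + Q.deg (snd xy)"
    using ex_has_greatest_nat[of "\<lambda>z. z \<in> ?N" z0 "\<lambda>z. Q.deg (fst z) + Q.deg (snd z)" n] dQ
    by fastforce
  define x where "x = (if Q.deg (fst xy) \<le> Q.deg (snd xy) then fst xy else snd xy)"
  define y where "y = (if Q.deg (fst xy) \<le> Q.deg (snd xy) then snd xy else fst xy)"
  have xyN: "(x, y) \<in> ?N" using xy Q.symI by (auto simp: x_def y_def)
  have le: "Q.deg x \<le> Q.deg y" by (auto simp: x_def y_def)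
  have xymax': "Q.deg u + Q.deg v \<le> Q.deg x + Q.deg y" if "(u, v) \<in> ?N" for u v
    using xymax[OF that] by (auto simp: x_def y_def)
  define i where "i = Q.deg x"
  have i2: "2 * t \<le> i" using Q.min_degree[of x y] xyN by (auto simp: i_def)
  have sum: "Q.deg x + Q.deg y + 2 \<le> n" by (rule dQ[OF xyN])
  define D0 where "D0 = V - {y} - Q.nbs y"
  have "card D0 = n - 1 - Q.deg y"
    using xyN Q.nbs_sub[of y] Q.fin_nbs[of y] finV by (simp add: D0_def n_def card_Diff_subset)
  then have "i + 1 \<le> card D0" using sum by (simp add: i_def)
  then obtain D where D: "D \<subseteq> D0" "card D = i + 1" "finite D"
    by (meson obtain_subset_with_card_n)
  define B where "B = (n - (i + 1)) * (n - (i + 1) - 1) + 2 * ((i + 1) * i)"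
  \<comment> \<open>Since z and y are not adjacent, maximality gives deg z + deg y \<le> deg x + deg
    y.\<close>
  have "Q.deg z \<le> i" if "z \<in> D" for z
    using xymax'[of z y] that D(1) xyN Q.symI by (auto simp: D0_def i_def)
  then have up: "card Q + card (Q \<inter> D \<times> D) \<le> B"
    using Q.card_rel_bound[of D i] D by (auto simp: D0_def n_def B_def)
  \<comment> \<open>\<open>D\<close> spans at least i + 1 - |I| edges, which improves the term 2 (i
    + 1) i of \<open>B\<close> to 2 (i + 1) (i - 1) + 2 |I|.\<close>
  obtain I where I: "I \<subseteq> D" "Q \<inter> I \<times> I = {}"
    "2 * card D \<le> 2 * card I + card (Q \<inter> D \<times> D)"
    using Q.independent_subset[OF D(3)] by blast
  have "card Q + 2 * (i + 1) \<le> B + 2 * card I"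
    using add_mono[OF up I(3)] by (simp add: D(2))
  then have "real (card Q + 2 * (i + 1)) \<le> real (B + 2 * card I)"
    by (simp only: of_nat_le_iff)
  \<comment> \<open>Writing n as i + 2 + e removes the truncated subtractions in
    \<open>B\<close>.\<close>
  moreover obtain e where "n = i + 2 + e"
    using sum le_Suc_ex[of "i + 2" n] by (auto simp: i_def)
  ultimately have cQ: "real (card Q) \<le> (real n - i - 1) * (real n - i - 2) + 2 * (real i + 1) * (real i - 1)
      + 2 * card I"
    by (simp add: B_def algebra_simps)
  have "(t + 1) * card I \<le> n"
  \<comment> \<open>Sets of at most one vertex are covered by the lower bound \<open>big\<close> on
    n.\<close>
  proof (cases "card I \<ge> 2")
    case True
    then show ?thesis using Q.independent_card[of I] I D by (auto simp: D0_def n_def)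
  next
    case False
    then have "(t + 1) * card I \<le> (t + 1) * (2 * t + 1)" using t_ge by (intro mult_left_mono) auto
    then show ?thesis using big by (simp add: mult.commute)
  qed
  moreover have "2 * real i + 2 \<le> real n" using sum le by (simp add: i_def)
  ultimately have "real (card Q) < (real n - 2 * t) * (real n - 2 * t - 1) + 6 * t\<^sup>2"
    using edge_bound_less[OF t_ge big i2, of "card I"] cQ by linarith
  moreover have "card R \<le> card Q" using Q(1) Q.finR by (rule card_mono[rotated])
  ultimately show False using many by (simp add: n_def)
qed

end

section \<open>Translation to vertex and edge sets\<close>

definition adjacency :: "'a ugraph \<Rightarrow> ('a \<times> 'a) set" where
  "adjacency G = {(u, v). {u, v} \<in> edges G}"

lemma rel_graph_adjacency: "simple_graph G \<Longrightarrow> rel_graph (verts G) (adjacency G)"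
  by (auto simp: rel_graph_def simple_graph_def adjacency_def sym_def irrefl_def insert_commute)

lemma card_adjacency:
  assumes G: "simple_graph G"
  shows "card (adjacency G) = 2 * card (edges G)"
proof -
  have c2: "card e = 2" if "e \<in> edges G" for e using G that by (auto simp: simple_graph_def)
  have fin: "finite (edges G)"
    using G by (auto simp: simple_graph_def intro: finite_subset[of _ "Pow (verts G)"])
  have c: "card {(u, v). {u, v} = e} = 2 \<and> finite {(u, v). {u, v} = e}" if e: "e \<in> edges G" for e
  proof -
    obtain a b where ab: "e = {a, b}" "a \<noteq> b" using c2[OF e] by (meson card_2_iff)
    then have "{(u, v). {u, v} = e} = {(a, b), (b, a)}" by (auto simp: doubleton_eq_iff)
    then show ?thesis using ab by simp
  qed
  have "adjacency G = (\<Union>e\<in>edges G. {(u, v). {u, v} = e})" by (auto simp: adjacency_def)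
  also have "card \<dots> = (\<Sum>e\<in>edges G. card {(u, v). {u, v} = e})"
    by (rule card_UN_disjoint) (use fin c in auto)
  also have "\<dots> = 2 * card (edges G)" using c by simp
  finally show ?thesis .
qed

lemma equiv_reachable: "equiv (verts G) (reachable G)"
proof (rule equivI)
  have "sym ({(u, v). {u, v} \<in> edges G}\<^sup>*)"
    by (rule sym_rtrancl) (auto simp: sym_def insert_commute)
  then show "sym (reachable G)" by (auto simp: reachable_def sym_def)
  show "trans (reachable G)" unfolding reachable_def
    by (rule transI) (auto intro: rtrancl_trans)
qed (auto simp: reachable_def refl_on_def)

text \<open>A walk starting at \<open>u\<close> cannot leave \<open>X\<close>, so it reaches no
  other vertex of \<open>T\<close>, and different vertices of \<open>T\<close> represent different
  components.\<close>

lemma card_le_num_components: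
  assumes fin: "finite (verts G)" and T: "T \<subseteq> verts G"
    and sep: "\<And>u. u \<in> T \<Longrightarrow> \<exists>X. u \<in> X \<and> X \<inter> T = {u} \<and> (\<forall>a\<in>X. \<forall>b. {a, b} \<in> edges G \<longrightarrow> b \<in> X)"
  shows "card T \<le> num_components G"
proof -
  have "inj_on (\<lambda>u. reachable G `` {u}) T"
  proof (rule inj_onI)
    fix u v assume uv: "u \<in> T" "v \<in> T" "reachable G `` {u} = reachable G `` {v}"
    then have "(u, v) \<in> reachable G"
      by (intro eq_equiv_class[OF _ equiv_reachable]) (use T in auto)
    then have path: "(u, v) \<in> {(u, v). {u, v} \<in> edges G}\<^sup>*" by (simp add: reachable_def)
    obtain X where X: "u \<in> X" "X \<inter> T = {u}" "\<forall>a\<in>X. \<forall>b. {a, b} \<in> edges G \<longrightarrow> b \<in> X"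
      using sep[OF uv(1)] by blast
    from path have "v \<in> X" by (induction rule: rtrancl_induct) (use X in auto)
    then show "u = v" using X(2) uv(2) by (metis IntI singletonD)
  qed
  moreover have "(\<lambda>u. reachable G `` {u}) ` T \<subseteq> components G"
    using T by (auto simp: components_def quotient_def)
  moreover have "finite (components G)"
    unfolding components_def by (rule finite_quotient[OF fin]) (auto simp: reachable_def)
  ultimately show ?thesis unfolding num_components_def by (rule card_inj_on_le)
qed

text \<open>The separated vertices lie in different components of the graph minus \<open>S\<close>.
  With two or more of them \<open>S\<close> is a vertex cut, and the toughness inequality for the
  number of components gives the one for \<open>card T\<close>.\<close>

lemma tough_graph_adjacency:
  assumes "t \<ge> 4" "simple_graph G" "tough t G"
  shows "tough_graph (verts G) (adjacency G) t"
proof (intro tough_graph.intro tough_graph_axioms.intro rel_graph_adjacency assms)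
  fix S T assume a: "S \<subseteq> verts G" "T \<subseteq> verts G - S" "2 \<le> card T"
    "\<And>u. u \<in> T \<Longrightarrow> \<exists>X. u \<in> X \<and> X \<inter> T = {u} \<and>
       (\<forall>a\<in>X. \<forall>b. (a, b) \<in> adjacency G \<longrightarrow> b \<notin> S \<longrightarrow> b \<in> X)"
  have le: "card T \<le> num_components (delete_verts G S)"
  proof (rule card_le_num_components)
    fix u assume "u \<in> T"
    from a(4)[OF this] obtain X where "u \<in> X \<and> X \<inter> T = {u} \<and>
      (\<forall>a\<in>X. \<forall>b. (a, b) \<in> adjacency G \<longrightarrow> b \<notin> S \<longrightarrow> b \<in> X)" ..
    then show "\<exists>X. u \<in> X \<and> X \<inter> T = {u} \<and>
        (\<forall>a\<in>X. \<forall>b. {a, b} \<in> edges (delete_verts G S) \<longrightarrow> b \<in> X)"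
      by (intro exI[of _ X]) (auto simp: delete_verts_def adjacency_def)
  qed (use a assms in \<open>auto simp: delete_verts_def simple_graph_def\<close>)
  then have "vertex_cut G S" using a by (simp add: vertex_cut_def)
  then have "t * real (num_components (delete_verts G S)) \<le> real (card S)"
    using assms(3) by (simp add: tough_def)
  moreover have "t * real (card T) \<le> t * real (num_components (delete_verts G S))"
    using le assms(1) by (intro mult_left_mono) auto
  ultimately show "t * real (card T) \<le> real (card S)" by linarith
qed

lemma is_cycle_if_closed_path:
  assumes p: "closed_path (adjacency G) p" "set p \<subseteq> verts G" "3 \<le> length p"
  shows "is_cycle G p"
  unfolding is_cycle_def
proof (intro conjI allI impI)
  fix i assume i: "i < length p"
  show "{p ! i, p ! (Suc i mod length p)} \<in> edges G"
  proof (cases "Suc i < length p")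
    case True
    then show ?thesis
      using p(1) walk_in_nth[of "adjacency G" p i] by (simp add: closed_path_def adjacency_def)
  next
    case False
    then have "length p = Suc i" using i by simp
    moreover have "(last p, hd p) \<in> adjacency G" using p by (auto simp: closed_path_def)
    moreover have "p \<noteq> []" using p(3) by auto
    ultimately show ?thesis by (simp add: adjacency_def hd_conv_nth last_conv_nth)
  qed
qed (use p in \<open>auto simp: closed_path_def\<close>)

theorem theorem1p1:
  fixes G :: "'a ugraph" and t :: real and n m :: nat
  assumes "t \<ge> 4"
    and "simple_graph G"
    and "connected_graph G"
    and "tough t G"
    and "n = card (verts G)"
    and "m = card (edges G)"
    and "real n > 10 * t - 3"
    and "real m \<ge> ((real n - 2 * t) gchoose 2) + 3 * t\<^sup>2"
  shows "hamiltonian G \<and> (pancyclic G \<or> bipartite G)"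
proof -
  interpret tough_graph "verts G" "adjacency G" t
    using tough_graph_adjacency assms(1,2,4) by blast
  have cR: "card (adjacency G) = 2 * m" using card_adjacency assms by simp
  have m: "(real n - 2 * t) * (real n - 2 * t - 1) + 6 * t\<^sup>2 \<le> 2 * real m"
    using assms(8) by (simp add: gchoose_two_real)
  have n3: "n \<ge> 3" using assms(1,7) by linarith
  have "ham" by (rule ham_if_many_edges) (use m cR n3 assms(5) in auto)
  then obtain p where p: "closed_path (adjacency G) p" "set p = verts G" by (auto simp: ham_def)
  have len: "length p = n"
    using p assms(5) distinct_card[of p] by (simp add: closed_path_def)
  have cyc: "is_cycle G p" using p len n3 by (intro is_cycle_if_closed_path) auto
  then have H: "hamiltonian G" using p by (auto simp: hamiltonian_def)
  \<comment> \<open>The bound n > 10 t - 3 makes \<open>d\<close> positive, and \<open>2 * E\<close>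
    minus the square of n has only positive coefficients in \<open>d\<close> and \<open>s\<close>.
    Together with \<open>E \<le> 2 * m\<close> this is the edge condition of Bondy's
    theorem.\<close>
  have "real n * real n < 4 * real m"
  proof -
    define E where "E = (real n - 2 * t) * (real n - 2 * t - 1) + 6 * t\<^sup>2"
    define d where "d = real n - (10 * t - 3)"
    define s where "s = t - 4"
    have pos: "0 < d" "0 \<le> s" using assms(1,7) by (auto simp: d_def s_def)
    have eq: "real n = d + 10 * s + 37" "t = s + 4" by (auto simp: d_def s_def)
    have "0 \<le> s * d" "0 \<le> d\<^sup>2" "0 \<le> s\<^sup>2" using pos by simp_all
    moreover have "2 * E - real n * real n =
        d\<^sup>2 + 12 * (s * d) + 40 * d + 40 * s\<^sup>2 + 268 * s + 447"
      unfolding E_def eq by (simp add: power2_eq_square algebra_simps)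
    ultimately have "real n * real n < 2 * E"
      using pos by linarith
    then show ?thesis using m unfolding E_def[symmetric] by linarith
  qed
  then have many: "card (verts G) * card (verts G) < 2 * card (adjacency G)"
    using cR assms(5) by (metis (mono_tags) mult.assoc numeral_Bit0_eq_double of_nat_less_iff of_nat_mult
        of_nat_numeral)
  have "pancyclic G"
    unfolding pancyclic_def
  proof (intro allI impI)
    fix l assume l: "3 \<le> l \<and> l \<le> card (verts G)"
    show "\<exists>p. is_cycle G p \<and> length p = l"
    \<comment> \<open>Length n is the Hamiltonian cycle; the shorter lengths come from
      \<open>closed_path_of_length\<close>.\<close>
    proof (cases "l = n")
      case True
      then show ?thesis using cyc len by blast
    next
      case False
      then have "l < card (verts G)" using l assms(5) by simp
      then obtain q where "closed_path (adjacency G) q" "set q \<subseteq> verts G" "length q = l"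
        using closed_path_of_length[OF \<open>ham\<close> many] l by blast
      then show ?thesis using is_cycle_if_closed_path l by blast
    qed
  qed
  with H show ?thesis by blast
qed

end
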